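(* When the link length $L\to0$ (with the storage capacity $\Lambda$ kept fixed), the demand $d(t)$ and supply $s(t)$ of the link queue model become the following demand and supply of a point queue, for $t\ge0^+$: $$d(t)=H(\lambda(t)),\qquad s(t)=H(\Lambda-\lambda(t)),$$ where $\lambda(t)=\rho(t)$ is the number of vehicles in the queue.
   Context: A homogeneous road link has length $L>0$, $N$ lanes, free-flow speed $V>0$, congested shock wave speed $W>0$ (in absolute value), jam density $K>0$ per lane. Put $U=\frac{VW}{V+W}$, $T_1=L/V$, $T_2=L/W$, $T_3=L/U$. The storage capacity is $\Lambda=NLK>0$. A point queue is the limit of the link as $L\to0$ and $N=\Lambda/(LK)\to\infty$ with $\Lambda$ fixed; then $T_1,T_2,T_3\to0^+$. Let $\rho(t)\in[0,\Lambda]$ be the number of vehicles on the link at time $t$; for a point queue it coincides with the queue size $\lambda(t)$. In the link queue model the demand and supply are $$d(t)=\min\Big\{\frac{\rho(t)}{T_1},\frac{\Lambda}{T_3}\Big\},\qquad s(t)=\min\Big\{\frac{\Lambda-\rho(t)}{T_2},\frac{\Lambda}{T_3}\Big\}.$$ For $y\ge0$, $H(y)=\lim_{\Delta t\to0^+}\frac{y}{\Delta t}$, i.e. $H(0)=0$ and $H(y)=\infty$ for $y>0$. "$t\ge0^+$" means for all $t>0$ together with the limiting initial instant. *)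

theory Defs
  imports "HOL-Analysis.Analysis"
begin

definition critical_speed :: "real \<Rightarrow> real \<Rightarrow> real" where
  "critical_speed V W = V * W / (V + W)"

text \<open>A link has length \<open>L\<close>, \<open>N\<close> lanes and jam density \<open>K\<close> per lane. The number of lanes
  is a real number, since it equals \<open>\<Lambda> / (L K)\<close> along the limit \<open>L \<rightarrow> 0\<close> with fixed storage
  capacity \<open>\<Lambda>\<close>.\<close>

definition storage_capacity :: "real \<Rightarrow> real \<Rightarrow> real \<Rightarrow> real" where
  "storage_capacity N L K = N * L * K"

text \<open>The quotients of \<open>L\<close> by a speed are the times \<open>T\<^sub>1 = L / V\<close>, \<open>T\<^sub>2 = L / W\<close> and
  \<open>T\<^sub>3 = L / U\<close>; the last argument \<open>r\<close> is the current number of vehicles on the link.\<close>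

definition link_demand :: "real \<Rightarrow> real \<Rightarrow> real \<Rightarrow> real \<Rightarrow> real \<Rightarrow> real \<Rightarrow> real" where
  "link_demand V W K N L r =
     (let T1 = L / V; T3 = L / critical_speed V W
      in min (r / T1) (storage_capacity N L K / T3))"

definition link_supply :: "real \<Rightarrow> real \<Rightarrow> real \<Rightarrow> real \<Rightarrow> real \<Rightarrow> real \<Rightarrow> real" where
  "link_supply V W K N L r =
     (let T2 = L / W; T3 = L / critical_speed V W
      in min ((storage_capacity N L K - r) / T2) (storage_capacity N L K / T3))"

text \<open>The limit is taken in the extended reals; only arguments \<open>y \<ge> 0\<close> are meant.\<close>

definition H :: "real \<Rightarrow> ereal" where
  "H y = Lim (at_right 0) (\<lambda>\<Delta>t. ereal (y / \<Delta>t))"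

lemma H_zero: "H 0 = 0"
  unfolding H_def by (intro tendsto_Lim) (simp_all add: zero_ereal_def)

lemma H_pos:
  assumes "y > 0"
  shows "H y = \<infinity>"
proof -
  have "filterlim (\<lambda>h. y * inverse h) at_top (at_right 0)"
    using assms by (intro filterlim_tendsto_pos_mult_at_top[OF tendsto_const]
        filterlim_inverse_at_top_right)
  then show ?thesis
    unfolding H_def
    by (intro tendsto_Lim) (simp_all add: tendsto_PInfty_eq_at_top divide_inverse)
qed

end

theory Submission
  imports Defs
begin

(* On a link of length L > 0, demand and supply have the form a / L with a = min (r c) (\<Lambda> U):
   r is \<rho> and c is V for the demand, r is \<Lambda> - \<rho> and c is W for the supply. Since \<Lambda> U > 0,
   the number a vanishes or is positive together with r, and H depends on nothing else. *)

lemma H_cong: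
  assumes "x \<ge> 0" and "y \<ge> 0" and "x = 0 \<longleftrightarrow> y = 0"
  shows "H x = H y"
  using assms by (cases "x = 0") (auto simp: H_pos)

text \<open>\<open>H\<close> is defined through \<open>Lim\<close>, a definite description, so its
  value alone does not give convergence of the quotients. That is shown here, separately for zero
  and positive \<open>y\<close>.\<close>

lemma tendsto_H:
  assumes "y \<ge> 0"
  shows "((\<lambda>h. ereal (y / h)) \<longlongrightarrow> H y) (at_right 0)"
proof (cases "y = 0")
  case True
  then show ?thesis by (simp add: H_zero zero_ereal_def)
next
  case False
  then have "y > 0" using assms by simp
  then have "filterlim (\<lambda>h. y * inverse h) at_top (at_right 0)"
    by (intro filterlim_tendsto_pos_mult_at_top[OF tendsto_const]
        filterlim_inverse_at_top_right)
  then show ?thesis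
    using \<open>y > 0\<close> by (simp add: H_pos tendsto_PInfty_eq_at_top divide_inverse)
qed

lemma tendsto_H_min:
  fixes r c Q U :: real
  assumes "r \<ge> 0" and "c > 0" and "Q > 0" and "U > 0"
  shows "((\<lambda>L. ereal (min (r / (L / c)) (Q / (L / U)))) \<longlongrightarrow> H r) (at_right 0)"
proof -
  have "H r = H (min (r * c) (Q * U))"
    using assms by (intro H_cong) (auto simp: min_def)
  moreover have "((\<lambda>L. ereal (min (r * c) (Q * U) / L)) \<longlongrightarrow> H (min (r * c) (Q * U))) (at_right 0)"
    using assms by (intro tendsto_H) simp
  \<comment> \<open>Pulling the division out of the minimum needs \<open>L > 0\<close>, since a
    negative divisor would turn the minimum into a maximum. The right-sided filter sees only such
    \<open>L\<close>.\<close>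
  moreover have "\<forall>\<^sub>F L in at_right 0.
      ereal (min (r * c) (Q * U) / L) = ereal (min (r / (L / c)) (Q / (L / U)))"
    using eventually_at_right_less[of "0::real"]
    by eventually_elim (simp add: min_divide_distrib_right)
  ultimately show ?thesis
    by (simp add: tendsto_cong)
qed

lemma critical_speed_pos: "V > 0 \<Longrightarrow> W > 0 \<Longrightarrow> critical_speed V W > 0"
  by (simp add: critical_speed_def)

lemma eventually_at_right_0I:
  assumes "\<And>L::real. L > 0 \<Longrightarrow> P L"
  shows "eventually P (at_right 0)"
  using eventually_at_right_less[of "0::real"] by eventually_elim (rule assms)

text \<open>The capacity is known to be \<open>Q\<close> only for positive \<open>L\<close>, so the
  demand agrees with the form in \<open>tendsto_H_min\<close> eventually at the right of 0, which
  suffices for the limit.\<close>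

lemma link_demand_tendsto_H:
  assumes "V > 0" and "W > 0" and "Q > 0"
    and capacity: "\<And>L. L > 0 \<Longrightarrow> storage_capacity (N L) L K = Q"
    and "r \<ge> 0"
  shows "((\<lambda>L. ereal (link_demand V W K (N L) L r)) \<longlongrightarrow> H r) (at_right 0)"
  by (rule Lim_transform_eventually[OF tendsto_H_min[of r V Q "critical_speed V W"]])
     (use assms critical_speed_pos in
       \<open>auto intro!: eventually_at_right_0I simp: link_demand_def\<close>)

lemma link_supply_tendsto_H:
  assumes "V > 0" and "W > 0" and "Q > 0"
    and capacity: "\<And>L. L > 0 \<Longrightarrow> storage_capacity (N L) L K = Q"
    and "r \<le> Q"
  shows "((\<lambda>L. ereal (link_supply V W K (N L) L r)) \<longlongrightarrow> H (Q - r)) (at_right 0)"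
  by (rule Lim_transform_eventually[OF tendsto_H_min[of "Q - r" W Q "critical_speed V W"]])
     (use assms critical_speed_pos in
       \<open>auto intro!: eventually_at_right_0I simp: link_supply_def\<close>)

text \<open>Continuity in the number of vehicles at fixed length, used for the limiting initial
  instant. With quotients written as products with constant inverses, no condition on
  \<open>L\<close> arises.\<close>

lemma tendsto_link_demand:
  assumes "(f \<longlongrightarrow> r) F"
  shows "((\<lambda>t. link_demand V W K n L (f t)) \<longlongrightarrow> link_demand V W K n L r) F"
  unfolding link_demand_def Let_def divide_inverse by (intro tendsto_intros assms)

lemma tendsto_link_supply:
  assumes "(f \<longlongrightarrow> r) F"
  shows "((\<lambda>t. link_supply V W K n L (f t)) \<longlongrightarrow> link_supply V W K n L r) F"
  unfolding link_supply_def Let_def divide_inverse by (intro tendsto_intros assms)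

theorem lemma3p3:
  fixes V W K \<Lambda> :: real
    and N :: "real \<Rightarrow> real"
    and \<rho> queue :: "real \<Rightarrow> real"
  assumes "V > 0" and "W > 0" and "K > 0" and "\<Lambda> > 0"
    and fixed_capacity: "\<And>L. L > 0 \<Longrightarrow> storage_capacity (N L) L K = \<Lambda>"
    and range: "\<And>t. t > 0 \<Longrightarrow> \<rho> t \<in> {0..\<Lambda>}"
    and queue_size: "\<And>t. t > 0 \<Longrightarrow> queue t = \<rho> t"
  shows
    "(\<forall>t>0.
        ((\<lambda>L. ereal (link_demand V W K (N L) L (\<rho> t))) \<longlongrightarrow> H (queue t)) (at_right 0) \<and>
        ((\<lambda>L. ereal (link_supply V W K (N L) L (\<rho> t))) \<longlongrightarrow> H (\<Lambda> - queue t)) (at_right 0)) \<and>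
     (\<forall>queue0. (queue \<longlongrightarrow> queue0) (at_right 0) \<longrightarrow>
        (\<exists>d0 s0.
           (\<forall>L>0. ((\<lambda>t. link_demand V W K (N L) L (\<rho> t)) \<longlongrightarrow> d0 L) (at_right 0)) \<and>
           (\<forall>L>0. ((\<lambda>t. link_supply V W K (N L) L (\<rho> t)) \<longlongrightarrow> s0 L) (at_right 0)) \<and>
           ((\<lambda>L. ereal (d0 L)) \<longlongrightarrow> H queue0) (at_right 0) \<and>
           ((\<lambda>L. ereal (s0 L)) \<longlongrightarrow> H (\<Lambda> - queue0)) (at_right 0)))"
proof (intro conjI allI impI)
  note demand_lim = link_demand_tendsto_H[where N = N, OF \<open>V > 0\<close> \<open>W > 0\<close> \<open>\<Lambda> > 0\<close> fixed_capacity]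
  note supply_lim = link_supply_tendsto_H[where N = N, OF \<open>V > 0\<close> \<open>W > 0\<close> \<open>\<Lambda> > 0\<close> fixed_capacity]
  {
    fix t :: real
    assume "t > 0"
    then show "((\<lambda>L. ereal (link_demand V W K (N L) L (\<rho> t))) \<longlongrightarrow> H (queue t)) (at_right 0)"
      using range[of t] by (simp add: queue_size demand_lim)
    show "((\<lambda>L. ereal (link_supply V W K (N L) L (\<rho> t))) \<longlongrightarrow> H (\<Lambda> - queue t)) (at_right 0)"
      using \<open>t > 0\<close> range[of t] by (simp add: queue_size supply_lim)
  next
    \<comment> \<open>The initial instant does not follow from the case \<open>t > 0\<close> by
      letting \<open>t\<close> tend to 0, because \<open>H\<close> jumps at 0: for a queue of size
      \<open>t\<close> near 0, \<open>H\<close> is infinite, yet \<open>H 0 = 0\<close>. So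
      \<open>t\<close> tends to 0 first, at fixed \<open>L\<close>, and \<open>L\<close>
      afterwards.\<close>
    fix queue0
    assume "(queue \<longlongrightarrow> queue0) (at_right 0)"
    then have lim: "(\<rho> \<longlongrightarrow> queue0) (at_right 0)"
      by (rule Lim_transform_eventually) (simp add: eventually_at_right_0I queue_size)
    \<comment> \<open>The bounds are assumed only for \<open>t > 0\<close>; they pass to the limit
      because the interval is closed.\<close>
    have "queue0 \<in> {0..\<Lambda>}"
      by (rule Lim_in_closed_set[OF _ _ _ lim])
         (simp_all add: eventually_at_right_0I range del: atLeastAtMost_iff)
    then have "queue0 \<ge> 0" and "queue0 \<le> \<Lambda>"
      by simp_all
    then show "\<exists>d0 s0.
        (\<forall>L>0. ((\<lambda>t. link_demand V W K (N L) L (\<rho> t)) \<longlongrightarrow> d0 L) (at_right 0)) \<and>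
        (\<forall>L>0. ((\<lambda>t. link_supply V W K (N L) L (\<rho> t)) \<longlongrightarrow> s0 L) (at_right 0)) \<and>
        ((\<lambda>L. ereal (d0 L)) \<longlongrightarrow> H queue0) (at_right 0) \<and>
        ((\<lambda>L. ereal (s0 L)) \<longlongrightarrow> H (\<Lambda> - queue0)) (at_right 0)"
      \<comment> \<open>By continuity the limits in \<open>t\<close> are the link demand and supply
        at \<open>queue0\<close>, and the limits in \<open>L\<close> then apply with
        \<open>r = queue0\<close>.\<close>
      by (intro exI[of _ "\<lambda>L. link_demand V W K (N L) L queue0"]
          exI[of _ "\<lambda>L. link_supply V W K (N L) L queue0"])
         (auto intro!: tendsto_link_demand tendsto_link_supply lim demand_lim supply_lim)
  }
qed

end
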